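(* For all $n\ge 10$, $\beta_n\ge\gamma_n$, where $\beta_{10}=\gamma_{10}=10$ and, for $n\ge 11$, $\beta_n=\beta_{n-1}\_n$ and $\gamma_n=n\_\gamma_{n-1}$.
   Context: For a positive integer $a$ with decimal expansion $a=\sum_{i=0}^{k} c_i 10^i$, $c_i\in\{0,\dots,9\}$, $c_k\neq 0$, and an integer $b\ge 10$, let $a\_b:=\sum_{i=0}^{k} c_i b^i$ (the decimal digit string of $a$ interpreted in base $b$). Thus $\beta_n=((\cdots((10\_11)\_12)\cdots)\_(n-1))\_n$ and $\gamma_n=n\_((n-1)\_(\cdots\_(12\_(11\_10))\cdots))$. *)

theory Defs
  imports Main
begin

text \<open>
  For \<open>a > 0\<close> the index set below is \<open>{0..k}\<close>, where \<open>k\<close> is the position of the leading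
  decimal digit of \<open>a\<close>, and \<open>a div 10 ^ i mod 10\<close> is the decimal digit of \<open>a\<close> at position \<open>i\<close>.
\<close>

definition rebase :: "nat \<Rightarrow> nat \<Rightarrow> nat" where
  "rebase a b = (\<Sum>i | 10 ^ i \<le> a. (a div 10 ^ i mod 10) * b ^ i)"

text \<open>Values at indices below 10 are irrelevant.\<close>

fun beta :: "nat \<Rightarrow> nat" where
  "beta n = (if n \<le> 10 then 10 else rebase (beta (n - 1)) n)"

fun gamma :: "nat \<Rightarrow> nat" where
  "gamma n = (if n \<le> 10 then 10 else rebase n (gamma (n - 1)))"

declare beta.simps [simp del] gamma.simps [simp del]

lemma beta_10: "beta 10 = 10"
  by (simp add: beta.simps)

lemma beta_rec: "n \<ge> 11 \<Longrightarrow> beta n = rebase (beta (n - 1)) n"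
  by (subst beta.simps) simp

lemma gamma_10: "gamma 10 = 10"
  by (simp add: gamma.simps)

lemma gamma_rec: "n \<ge> 11 \<Longrightarrow> gamma n = rebase n (gamma (n - 1))"
  by (subst gamma.simps) simp

lemma sum_digits_less:
  fixes c :: "nat \<Rightarrow> nat"
  assumes "\<And>i. i < m \<Longrightarrow> c i \<le> 9"
  shows "(\<Sum>i<m. c i * 10 ^ i) < 10 ^ m"
  using assms
proof (induction m)
  case (Suc m)
  have "(\<Sum>i<m. c i * 10 ^ i) < 10 ^ m" using Suc by simp
  moreover have "c m * 10 ^ m \<le> 9 * 10 ^ m" using Suc.prems[of m] by simp
  ultimately have "(\<Sum>i<m. c i * 10 ^ i) + c m * 10 ^ m < 10 ^ m + 9 * 10 ^ m"
    by (rule add_less_le_mono)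
  then show ?case by simp
qed simp

lemma sum_digits_nth:
  fixes c :: "nat \<Rightarrow> nat"
  assumes "\<And>i. i < m \<Longrightarrow> c i \<le> 9" and "j < m"
  shows "(\<Sum>i<m. c i * 10 ^ i) div 10 ^ j mod 10 = c j"
  using assms
proof (induction m)
  case (Suc m)
  let ?S = "\<Sum>i<m. c i * 10 ^ i"
  show ?case
  proof (cases "j = m")
    case True
    have "?S < 10 ^ m" using sum_digits_less[of m c] Suc.prems by simp
    then show ?thesis using True Suc.prems(1)[of m] by simp
  next
    case False
    then have jm: "j < m" using Suc.prems by simp
    then obtain d where d: "m = j + Suc d"
      using less_imp_Suc_add by fastforce
    have "(?S + c m * 10 ^ m) div 10 ^ j = (?S + (c m * 10 ^ Suc d) * 10 ^ j) div 10 ^ j"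
      by (simp add: d power_add ac_simps)
    also have "\<dots> = ?S div 10 ^ j + c m * 10 ^ Suc d"
      by (subst div_mult_self1) simp_all
    finally have "(?S + c m * 10 ^ m) div 10 ^ j mod 10
        = (?S div 10 ^ j + 10 * (c m * 10 ^ d)) mod 10"
      by (simp add: ac_simps)
    also have "\<dots> = ?S div 10 ^ j mod 10" by (rule mod_mult_self2)
    finally show ?thesis using Suc.IH Suc.prems jm by simp
  qed
qed simp

lemma rebase_expansion:
  fixes c :: "nat \<Rightarrow> nat"
  assumes "a = (\<Sum>i\<le>k. c i * 10 ^ i)"
    and "\<And>i. i \<le> k \<Longrightarrow> c i \<in> {0..9}" and "c k \<noteq> 0"
  shows "rebase a b = (\<Sum>i\<le>k. c i * b ^ i)"
proof -
  have a: "a = (\<Sum>i<Suc k. c i * 10 ^ i)"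
    using assms(1) by (simp add: lessThan_Suc_atMost)
  have c: "\<And>i. i < Suc k \<Longrightarrow> c i \<le> 9" using assms(2) by simp
  have up: "a < 10 ^ Suc k" unfolding a using c by (rule sum_digits_less)
  have "1 * 10 ^ k \<le> c k * 10 ^ k" using assms(3) by (intro mult_right_mono) auto
  then have lo: "10 ^ k \<le> a" unfolding a sum.lessThan_Suc by linarith
  have "(10::nat) ^ i \<le> a \<longleftrightarrow> i \<le> k" for i
  proof
    assume "(10::nat) ^ i \<le> a"
    then have "(10::nat) ^ i < 10 ^ Suc k" using up by (rule le_less_trans)
    then have "i < Suc k" by (rule power_less_imp_less_exp[rotated]) simp
    then show "i \<le> k" by simp
  next
    assume "i \<le> k"
    then have "(10::nat) ^ i \<le> 10 ^ k" by (intro power_increasing) auto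
    then show "10 ^ i \<le> a" using lo by (rule le_trans)
  qed
  then have "{i. (10::nat) ^ i \<le> a} = {..k}" by auto
  moreover have "a div 10 ^ i mod 10 = c i" if "i \<le> k" for i
    unfolding a by (rule sum_digits_nth) (use c that in auto)
  ultimately show ?thesis unfolding rebase_def by (intro sum.cong) auto
qed

end

theory Submission
  imports Defs
begin

text \<open>
  Rebasing satisfies two estimates: if \<open>10 ^ k \<le> a\<close> then \<open>a\<close> rebased to \<open>b\<close> is at least \<open>b ^ k\<close>,
  and \<open>a\<close> rebased to \<open>10 ^ m\<close> with \<open>m > 0\<close> is at most \<open>a ^ m\<close>. Suppose
  \<open>10 ^ (m + 4) \<le> \<beta>\<^sub>n\<^sub>-\<^sub>1\<close> and \<open>\<gamma>\<^sub>n\<^sub>-\<^sub>1 \<le> 10 ^ m\<close>. The estimates give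
  \<open>\<beta>\<^sub>n \<ge> n ^ (m + 4)\<close> and \<open>\<gamma>\<^sub>n \<le> n ^ m\<close>, and since \<open>n ^ 4 \<ge> 10 ^ 5\<close> for \<open>n \<ge> 18\<close>, enclosing \<open>n ^ m\<close>
  between consecutive powers of 10 restores the hypothesis for \<open>n\<close>. A gap of this size is first
  reached at \<open>n = 23\<close>; smaller \<open>n\<close> are computed.
\<close>

text \<open>Positions above the leading digit contribute 0, so any sufficiently large
  \<open>k\<close> serves; a fixed range makes values computable.\<close>

lemma rebase_eq_sum:
  assumes "a < 10 ^ k"
  shows "rebase a b = (\<Sum>i<k. (a div 10 ^ i mod 10) * b ^ i)"
  unfolding rebase_def
proof (rule sum.mono_neutral_left)
  show "{i. 10 ^ i \<le> a} \<subseteq> {..<k}"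
  proof
    fix i assume "i \<in> {i. 10 ^ i \<le> a}"
    then have "10 ^ i \<le> a" by simp
    then have "(10::nat) ^ i < 10 ^ k" using assms by (rule le_less_trans)
    then show "i \<in> {..<k}" by simp
  qed
qed auto

lemma sum_decimal_digits: "(\<Sum>i<k. (a div 10 ^ i mod 10) * 10 ^ i) = a mod (10 ^ k :: nat)"
proof (induction k)
  case (Suc k)
  have "a mod (10 ^ k * 10) = 10 ^ k * (a div 10 ^ k mod 10) + a mod 10 ^ k"
    by (rule mod_mult2_eq)
  then show ?case using Suc by (simp add: ac_simps)
qed simp

lemma rebase_10: "rebase a 10 = a"
proof -
  have "a < 10 ^ a" by (rule less_exp [THEN less_le_trans]) (simp add: power_mono)
  then show ?thesis by (simp add: rebase_eq_sum sum_decimal_digits)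
qed

lemma rebase_mono: "b \<le> c \<Longrightarrow> rebase a b \<le> rebase a c"
  unfolding rebase_def by (intro sum_mono mult_left_mono power_mono) auto

text \<open>The leading digit, at some position \<open>j\<close> with \<open>k \<le> j\<close>,
  alone contributes at least \<open>b ^ j\<close>.\<close>

lemma power_le_rebase:
  assumes "10 ^ k \<le> a" "b > 0"
  shows "b ^ k \<le> rebase a b"
proof -
  have "a \<ge> 1" using assms(1) by (rule le_trans [rotated]) simp
  then obtain j where j: "10 ^ j \<le> a" "a < 10 ^ (j + 1)"
    using ex_power_ivl1 [of 10 a] by auto
  have "(10::nat) ^ k < 10 ^ (j + 1)" using assms(1) j(2) by (rule le_less_trans)
  then have "k < j + 1" by (rule power_less_imp_less_exp [rotated]) simp
  then have "b ^ k \<le> b ^ j" using assms(2) by (intro power_increasing) auto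
  also have "a div 10 ^ j < 10" using j(2) by (simp add: less_mult_imp_div_less)
  then have "1 \<le> a div 10 ^ j mod 10" using j(1) by (simp add: div_greater_zero_iff Suc_le_eq)
  then have "b ^ j \<le> (a div 10 ^ j mod 10) * b ^ j" by simp
  also have "\<dots> \<le> (\<Sum>i<j+1. (a div 10 ^ i mod 10) * b ^ i)"
    by (rule member_le_sum) auto
  also have "\<dots> = rebase a b" using j(2) by (simp only: rebase_eq_sum)
  finally show ?thesis .
qed

text \<open>With \<open>m = Suc l\<close>, the weight \<open>(10 ^ m) ^ i\<close> splits as
  \<open>10 ^ i * (10 ^ i) ^ l\<close>. The second factor is at most \<open>a ^ l\<close>, and the
  first factors with their digits sum to \<open>a\<close>.\<close>

lemma rebase_power_10_le:
  assumes "m > 0"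
  shows "rebase a (10 ^ m) \<le> a ^ m"
proof -
  obtain l where m: "m = Suc l" using assms by (cases m) auto
  have "rebase a (10 ^ m) = (\<Sum>i | 10 ^ i \<le> a. (a div 10 ^ i mod 10) * 10 ^ i * (10 ^ i) ^ l)"
    unfolding rebase_def m
    by (simp add: power_mult_distrib mult.assoc flip: power_mult power_add)
       (simp add: ac_simps)
  also have "\<dots> \<le> (\<Sum>i | 10 ^ i \<le> a. (a div 10 ^ i mod 10) * 10 ^ i * a ^ l)"
    by (intro sum_mono mult_left_mono power_mono) auto
  also have "\<dots> = rebase a 10 * a ^ l" by (simp add: rebase_def sum_distrib_right)
  finally show ?thesis by (simp add: rebase_10 m)
qed

lemma beta_small:
  "beta 11 = 11" "beta 12 = 13" "beta 13 = 16" "beta 14 = 20" "beta 15 = 30" "beta 16 = 48"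
  "beta 17 = 76" "beta 18 = 132" "beta 19 = 420" "beta 20 = 1640" "beta 21 = 11991"
  "beta 22 = 249459" "beta 23 = 14103793"
  \<comment> \<open>The numbers rebased here, up to \<open>beta 22\<close>, have at most 6
    digits.\<close>
  by (simp_all add: beta_rec beta_10 rebase_eq_sum [where k = 6] lessThan_nat_numeral)

lemma gamma_small:
  "gamma 11 = 11" "gamma 12 = 13" "gamma 13 = 16" "gamma 14 = 20" "gamma 15 = 25" "gamma 16 = 31"
  "gamma 17 = 38" "gamma 18 = 46" "gamma 19 = 55" "gamma 20 = 110" "gamma 21 = 221"
  "gamma 22 = 444" "gamma 23 = 891"
  \<comment> \<open>Here it is the index, at most 23, that is rebased: 2 digits.\<close>
  by (simp_all add: gamma_rec gamma_10 rebase_eq_sum [where k = 2] lessThan_nat_numeral)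

lemma beta_gamma_gap:
  assumes "n \<ge> 23"
  shows "\<exists>m>0. gamma n \<le> 10 ^ m \<and> 10 ^ (m + 4) \<le> beta n"
  using assms
proof (induction n rule: nat_induct_at_least)
  case base
  show ?case by (rule exI [of _ 3]) (simp add: beta_small gamma_small)
next
  case (Suc n)
  define N where "N = Suc n"
  have N: "N \<ge> 24" using Suc.hyps by (simp add: N_def)
  obtain m where m: "m > 0" "gamma n \<le> 10 ^ m" "10 ^ (m + 4) \<le> beta n"
    using Suc.IH by blast
  have "gamma N = rebase N (gamma n)" using N gamma_rec [of N] by (simp add: N_def)
  also have "\<dots> \<le> rebase N (10 ^ m)" using m(2) by (rule rebase_mono)
  also have "\<dots> \<le> N ^ m" using m(1) by (rule rebase_power_10_le)
  finally have gamma: "gamma N \<le> N ^ m" .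
  have "N ^ (m + 4) \<le> rebase (beta n) N" using m(3) N by (intro power_le_rebase) auto
  also have "\<dots> = beta N" using N beta_rec [of N] by (simp add: N_def)
  finally have beta: "N ^ (m + 4) \<le> beta N" .
  obtain j where j: "10 ^ j \<le> N ^ m" "N ^ m < 10 ^ (j + 1)"
    using ex_power_ivl1 [of 10 "N ^ m"] N by auto
  \<comment> \<open>One of the five factors 10 pays for rounding \<open>N ^ m\<close> up to
    \<open>10 ^ (j + 1)\<close>; the other four restore the gap.\<close>
  have "(10::nat) ^ 5 \<le> 24 ^ 4" by simp
  also have "\<dots> \<le> N ^ 4" using N by (rule power_mono) simp
  finally have "(10::nat) ^ j * 10 ^ 5 \<le> N ^ m * N ^ 4" using j(1) by (intro mult_mono) auto
  then have "10 ^ (j + 1 + 4) \<le> N ^ (m + 4)" by (simp add: power_add)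
  then have "10 ^ (j + 1 + 4) \<le> beta N" using beta by (rule le_trans)
  moreover have "gamma N \<le> 10 ^ (j + 1)" using gamma j(2) by linarith
  ultimately show ?case unfolding N_def by (intro exI [of _ "j + 1"]) simp
qed

theorem theorem3:
  fixes n :: nat
  assumes "n \<ge> 10"
  shows "beta n \<ge> gamma n"
proof (cases "n \<ge> 23")
  case True
  then obtain m where m: "gamma n \<le> 10 ^ m" "10 ^ (m + 4) \<le> beta n"
    using beta_gamma_gap by blast
  have "(10::nat) ^ m \<le> 10 ^ (m + 4)" by (rule power_increasing) auto
  with m show ?thesis by linarith
next
  case False
  with assms have "n = 10 \<or> n = 11 \<or> n = 12 \<or> n = 13 \<or> n = 14 \<or> n = 15 \<or> n = 16 \<or> n = 17
      \<or> n = 18 \<or> n = 19 \<or> n = 20 \<or> n = 21 \<or> n = 22"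
    by presburger
  then show ?thesis by (auto simp: beta_10 gamma_10 beta_small gamma_small)
qed

end
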